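(* For every formula $\varphi$ of the language of monadic second-order logic over $\omega$-words, if $\vdash\varphi$ is derivable in $\mathsf{MSO}$, then $\vdash\lnot\lnot\varphi$ is derivable in $\mathsf{SMSO}$. (More generally, if $\vec\varphi\vdash\varphi$ is derivable in $\mathsf{MSO}$ then $\vec\varphi\vdash\lnot\lnot\varphi$ is derivable in $\mathsf{SMSO}$.)
   Context: \emph{Language.} Two-sorted: individual variables $x,y,z,\dots$, predicate variables $X,Y,Z,\dots$. Atomic formulae $\alpha$: $x\doteq y$, $x\leq y$, $\mathsf S(x,y)$, $\mathsf{Zero}(x)$, $x\in X$, $\top$, $\bot$. Deterministic formulae $\delta ::= \alpha\mid\delta\wedge\delta'\mid\lnot\varphi$; formulae $\varphi ::= \delta\mid\varphi\wedge\psi\mid\exists x\varphi\mid\exists X\varphi$ (no primitive $\vee,\to,\forall$). \emph{Substitution.} $\varphi[\psi[y]/X]$ is capture-avoiding replacement of every atom $t\in X$ by $\psi[t/y]$. \emph{Relativization:} $\alpha|\theta[y]:=\alpha$, commuting with $\wedge,\lnot,\exists X$, and $(\exists x\varphi)|\theta[y]:=\exists x(\theta[x/y]\wedge\varphi|\theta[y])$. A formula is \emph{uniformly bounded by $x$} if it has the form $\psi|(y\leq x)[y]$ and $x$ is its only free individual variable. \emph{Logical rules} (sequents $\vec\varphi\vdash\varphi$): axiom $\vec\varphi,\varphi\vdash\varphi$; cut; from $\vec\varphi\vdash\varphi$, $\vec\varphi\vdash\lnot\varphi$ infer $\vec\varphi\vdash\bot$; from $\vec\varphi,\varphi\vdash\bot$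 infer $\vec\varphi\vdash\lnot\varphi$; $\wedge$-intro and $\wedge$-eliminations; $\exists$-introductions from $\varphi[y/x]$ resp. $\varphi[Y/X]$; $\exists$-eliminations (from $\vec\varphi\vdash\exists x\varphi$ and $\vec\varphi,\varphi\vdash\psi$ infer $\vec\varphi\vdash\psi$, $x$ not free in $\vec\varphi,\psi$; same for $X$). \emph{Arithmetic rules} (common context $\vec\varphi$): $\vdash x\doteq x$; from $\varphi[y/x]$, $y\doteq z$ infer $\varphi[z/x]$; reflexivity, transitivity of $\leq$ and from $x\leq y,y\leq x$ infer $x\doteq y$; $\vdash\exists y\,\mathsf{Zero}(y)$; from $\mathsf{Zero}(x),\mathsf{Zero}(y)$ infer $x\doteq y$; $\vdash\exists y\,\mathsf S(x,y)$; from $\mathsf S(y,x),\mathsf S(z,x)$ infer $y\doteq z$; from $\mathsf S(x,y),\mathsf S(x,z)$ infer $y\doteq z$; from $\mathsf S(x,y),\mathsf{Zero}(y)$ infer $\bot$; from $\mathsf S(x,y)$ infer $x\leq y$; from $\mathsf S(y,y')$, $x\leq y'$, $\lnot(x\doteq y')$ infer $x\leq y$. \emph{$\mathsf{MSO}$}: logical and arithmetic rules, plus double negation elimination (from $\vec\varphi\vdash\lnot\lnot\varphi$ infer $\vec\varphi\vdash\varphi$), comprehension (from $\vec\varphi\vdash\varphi[\psi[y]/X]$ infer $\vec\varphi\vdash\exists X\varphi$) and induction (from $\vec\varphi,\mathsf{Zero}(z)\vdash\varphi[z/x]$ and $\vec\varphi,\mathsf S(y,z),\varphi[y/x]\vdash\varphi[z/x]$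 infer $\vec\varphi\vdash\varphi$, with $y,z$ not free in $\vec\varphi,\varphi$). \emph{$\mathsf{SMSO}$}: logical and arithmetic rules, plus negative comprehension (from $\vec\varphi\vdash\varphi[\psi[y]/X]$ infer $\vec\varphi\vdash\lnot\lnot\exists X\varphi$), induction restricted to deterministic $\varphi=\delta$, double negation elimination restricted to deterministic formulae, and synchronous comprehension (from $\vec\varphi\vdash\psi[\hat\varphi[y]/X]$ infer $\vec\varphi\vdash\exists X\psi$ with $\hat\varphi$ uniformly bounded by $y$). *)

theory Defs
  imports Main
begin

text \<open>
  Formulae are represented with de Bruijn indices, which makes substitution capture-avoiding and
  identifies formulae up to renaming of bound variables.  Individual and predicate variables
  have separate index spaces: \<open>ExI\<close> binds individual index 0 and \<open>ExP\<close> binds predicate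
  index 0 of its body.  \<open>Mem x X\<close> is $x \in X$, and \<open>Succ x y\<close> says that \<open>y\<close> is the successor of \<open>x\<close>.
\<close>

datatype form =
    Eq nat nat
  | Leq nat nat
  | Succ nat nat
  | IsZero nat
  | Mem nat nat
  | Top
  | Bot
  | And form form
  | Neg form
  | ExI form
  | ExP form

fun deterministic :: "form \<Rightarrow> bool" where
  "deterministic (And \<phi> \<psi>) \<longleftrightarrow> deterministic \<phi> \<and> deterministic \<psi>"
| "deterministic (ExI \<phi>) \<longleftrightarrow> False"
| "deterministic (ExP \<phi>) \<longleftrightarrow> False"
| "deterministic _ \<longleftrightarrow> True"

definition up :: "(nat \<Rightarrow> nat) \<Rightarrow> nat \<Rightarrow> nat" where
  "up f = case_nat 0 (\<lambda>n. Suc (f n))"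

primrec rename :: "(nat \<Rightarrow> nat) \<Rightarrow> (nat \<Rightarrow> nat) \<Rightarrow> form \<Rightarrow> form" where
  "rename f g (Eq x y) = Eq (f x) (f y)"
| "rename f g (Leq x y) = Leq (f x) (f y)"
| "rename f g (Succ x y) = Succ (f x) (f y)"
| "rename f g (IsZero x) = IsZero (f x)"
| "rename f g (Mem x X) = Mem (f x) (g X)"
| "rename f g Top = Top"
| "rename f g Bot = Bot"
| "rename f g (And \<phi> \<psi>) = And (rename f g \<phi>) (rename f g \<psi>)"
| "rename f g (Neg \<phi>) = Neg (rename f g \<phi>)"
| "rename f g (ExI \<phi>) = ExI (rename (up f) g \<phi>)"
| "rename f g (ExP \<phi>) = ExP (rename f (up g) \<phi>)"

definition shiftI :: "form \<Rightarrow> form" where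
  "shiftI = rename Suc id"

definition shiftP :: "form \<Rightarrow> form" where
  "shiftP = rename id Suc"

text \<open>
  A formula $\varphi[x]$ with a distinguished individual variable is a formula whose index 0
  stands for $x$ and whose index \<open>Suc n\<close> stands for the variable \<open>n\<close> of the surrounding scope
  (as for the body of \<open>ExI\<close>); likewise for predicate variables.  Since the only individual terms
  are variables, \<open>instI \<phi> y\<close> is $\varphi[y/x]$, \<open>instP \<phi> Y\<close> is $\varphi[Y/X]$, and
  \<open>substP \<phi> \<psi>\<close> is $\varphi[\psi[y]/X]$.
\<close>

definition instI :: "form \<Rightarrow> nat \<Rightarrow> form" where
  "instI \<phi> y = rename (case_nat y id) id \<phi>"

definition instP :: "form \<Rightarrow> nat \<Rightarrow> form" where
  "instP \<phi> Y = rename id (case_nat Y id) \<phi>"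

text \<open>
  The substitution \<open>\<sigma>\<close> maps each predicate variable \<open>X\<close> to a formula with a distinguished
  individual variable.  Renaming with \<open>up Suc\<close> shifts the other individual variables of that formula
  and keeps the distinguished one; \<open>Mem 0 X\<close> is the formula $(y \in X)[y]$, so it leaves \<open>X\<close> unchanged.
\<close>

primrec substPs :: "(nat \<Rightarrow> form) \<Rightarrow> form \<Rightarrow> form" where
  "substPs \<sigma> (Eq x y) = Eq x y"
| "substPs \<sigma> (Leq x y) = Leq x y"
| "substPs \<sigma> (Succ x y) = Succ x y"
| "substPs \<sigma> (IsZero x) = IsZero x"
| "substPs \<sigma> (Mem x X) = instI (\<sigma> X) x"
| "substPs \<sigma> Top = Top"
| "substPs \<sigma> Bot = Bot"
| "substPs \<sigma> (And \<phi> \<psi>) = And (substPs \<sigma> \<phi>) (substPs \<sigma> \<psi>)"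
| "substPs \<sigma> (Neg \<phi>) = Neg (substPs \<sigma> \<phi>)"
| "substPs \<sigma> (ExI \<phi>) = ExI (substPs (\<lambda>X. rename (up Suc) id (\<sigma> X)) \<phi>)"
| "substPs \<sigma> (ExP \<phi>) = ExP (substPs (case_nat (Mem 0 0) (\<lambda>X. shiftP (\<sigma> X))) \<phi>)"

definition substP :: "form \<Rightarrow> form \<Rightarrow> form" where
  "substP \<phi> \<psi> = substPs (case_nat \<psi> (\<lambda>X. Mem 0 X)) \<phi>"

text \<open>
  \<open>relativize \<theta> \<phi>\<close> is $\varphi|\theta[y]$.  Inside \<open>ExI\<close>, the distinguished index 0 of \<open>\<theta>\<close> coincides
  with the bound variable $x$, so that \<open>\<theta>\<close> itself represents $\theta[x/y]$ there.
\<close>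

primrec relativize :: "form \<Rightarrow> form \<Rightarrow> form" where
  "relativize \<theta> (Eq x y) = Eq x y"
| "relativize \<theta> (Leq x y) = Leq x y"
| "relativize \<theta> (Succ x y) = Succ x y"
| "relativize \<theta> (IsZero x) = IsZero x"
| "relativize \<theta> (Mem x X) = Mem x X"
| "relativize \<theta> Top = Top"
| "relativize \<theta> Bot = Bot"
| "relativize \<theta> (And \<phi> \<psi>) = And (relativize \<theta> \<phi>) (relativize \<theta> \<psi>)"
| "relativize \<theta> (Neg \<phi>) = Neg (relativize \<theta> \<phi>)"
| "relativize \<theta> (ExI \<phi>) = ExI (And \<theta> (relativize (rename (up Suc) id \<theta>) \<phi>))"
| "relativize \<theta> (ExP \<phi>) = ExP (relativize (shiftP \<theta>) \<phi>)"

primrec freeI :: "form \<Rightarrow> nat set" where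
  "freeI (Eq x y) = {x, y}"
| "freeI (Leq x y) = {x, y}"
| "freeI (Succ x y) = {x, y}"
| "freeI (IsZero x) = {x}"
| "freeI (Mem x X) = {x}"
| "freeI Top = {}"
| "freeI Bot = {}"
| "freeI (And \<phi> \<psi>) = freeI \<phi> \<union> freeI \<psi>"
| "freeI (Neg \<phi>) = freeI \<phi>"
| "freeI (ExI \<phi>) = {n. Suc n \<in> freeI \<phi>}"
| "freeI (ExP \<phi>) = freeI \<phi>"

text \<open>\<open>Leq 0 (Suc x)\<close> is $(y \leq x)[y]$.\<close>

definition uniformly_bounded :: "nat \<Rightarrow> form \<Rightarrow> bool" where
  "uniformly_bounded x \<phi> \<longleftrightarrow>
     (\<exists>\<psi>. \<phi> = relativize (Leq 0 (Suc x)) \<psi>) \<and> freeI \<phi> \<subseteq> {x}"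

datatype calculus = MSO | SMSO

text \<open>
  \<open>derivable c \<Gamma> \<phi>\<close> is derivability of the sequent $\Gamma \vdash \varphi$ in the calculus \<open>c\<close>.  The order of the
  formulae in a context is immaterial.  Eigenvariables are the indices freed by
  shifting the context: in \<open>exI_elim\<close> and \<open>exP_elim\<close> the eigenvariable is index 0, in the base case of
  \<open>induction\<close> $z$ is index 0 (so \<open>\<phi>\<close> itself is $\varphi[z/x]$), and in its step $z$ is index 0 and
  $y$ is index 1.
\<close>

inductive derivable :: "calculus \<Rightarrow> form list \<Rightarrow> form \<Rightarrow> bool" for c :: calculus where
  ax: "\<phi> \<in> set \<Gamma> \<Longrightarrow> derivable c \<Gamma> \<phi>"
| cut: "\<lbrakk>derivable c \<Gamma> \<psi>; derivable c (\<psi> # \<Gamma>) \<phi>\<rbrakk> \<Longrightarrow> derivable c \<Gamma> \<phi>"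
| neg_elim: "\<lbrakk>derivable c \<Gamma> \<phi>; derivable c \<Gamma> (Neg \<phi>)\<rbrakk> \<Longrightarrow> derivable c \<Gamma> Bot"
| neg_intro: "derivable c (\<phi> # \<Gamma>) Bot \<Longrightarrow> derivable c \<Gamma> (Neg \<phi>)"
| and_intro: "\<lbrakk>derivable c \<Gamma> \<phi>; derivable c \<Gamma> \<psi>\<rbrakk> \<Longrightarrow> derivable c \<Gamma> (And \<phi> \<psi>)"
| and_elim1: "derivable c \<Gamma> (And \<phi> \<psi>) \<Longrightarrow> derivable c \<Gamma> \<phi>"
| and_elim2: "derivable c \<Gamma> (And \<phi> \<psi>) \<Longrightarrow> derivable c \<Gamma> \<psi>"
| exI_intro: "derivable c \<Gamma> (instI \<phi> y) \<Longrightarrow> derivable c \<Gamma> (ExI \<phi>)"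
| exP_intro: "derivable c \<Gamma> (instP \<phi> Y) \<Longrightarrow> derivable c \<Gamma> (ExP \<phi>)"
| exI_elim: "\<lbrakk>derivable c \<Gamma> (ExI \<phi>); derivable c (\<phi> # map shiftI \<Gamma>) (shiftI \<psi>)\<rbrakk>
    \<Longrightarrow> derivable c \<Gamma> \<psi>"
| exP_elim: "\<lbrakk>derivable c \<Gamma> (ExP \<phi>); derivable c (\<phi> # map shiftP \<Gamma>) (shiftP \<psi>)\<rbrakk>
    \<Longrightarrow> derivable c \<Gamma> \<psi>"
| eq_refl: "derivable c \<Gamma> (Eq x x)"
| eq_subst: "\<lbrakk>derivable c \<Gamma> (instI \<phi> y); derivable c \<Gamma> (Eq y z)\<rbrakk> \<Longrightarrow> derivable c \<Gamma> (instI \<phi> z)"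
| leq_refl: "derivable c \<Gamma> (Leq x x)"
| leq_trans: "\<lbrakk>derivable c \<Gamma> (Leq x y); derivable c \<Gamma> (Leq y z)\<rbrakk> \<Longrightarrow> derivable c \<Gamma> (Leq x z)"
| leq_antisym: "\<lbrakk>derivable c \<Gamma> (Leq x y); derivable c \<Gamma> (Leq y x)\<rbrakk> \<Longrightarrow> derivable c \<Gamma> (Eq x y)"
| zero_exists: "derivable c \<Gamma> (ExI (IsZero 0))"
| zero_unique: "\<lbrakk>derivable c \<Gamma> (IsZero x); derivable c \<Gamma> (IsZero y)\<rbrakk> \<Longrightarrow> derivable c \<Gamma> (Eq x y)"
| succ_exists: "derivable c \<Gamma> (ExI (Succ (Suc x) 0))"
| succ_inj: "\<lbrakk>derivable c \<Gamma> (Succ y x); derivable c \<Gamma> (Succ z x)\<rbrakk> \<Longrightarrow> derivable c \<Gamma> (Eq y z)"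
| succ_unique: "\<lbrakk>derivable c \<Gamma> (Succ x y); derivable c \<Gamma> (Succ x z)\<rbrakk> \<Longrightarrow> derivable c \<Gamma> (Eq y z)"
| succ_nonzero: "\<lbrakk>derivable c \<Gamma> (Succ x y); derivable c \<Gamma> (IsZero y)\<rbrakk> \<Longrightarrow> derivable c \<Gamma> Bot"
| succ_leq: "derivable c \<Gamma> (Succ x y) \<Longrightarrow> derivable c \<Gamma> (Leq x y)"
| leq_succ: "\<lbrakk>derivable c \<Gamma> (Succ y y'); derivable c \<Gamma> (Leq x y'); derivable c \<Gamma> (Neg (Eq x y'))\<rbrakk>
    \<Longrightarrow> derivable c \<Gamma> (Leq x y)"
| dne: "\<lbrakk>c = MSO \<or> c = SMSO \<and> deterministic \<phi>; derivable c \<Gamma> (Neg (Neg \<phi>))\<rbrakk>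
    \<Longrightarrow> derivable c \<Gamma> \<phi>"
| induction: "\<lbrakk>c = MSO \<or> c = SMSO \<and> deterministic \<phi>;
      derivable c (IsZero 0 # map shiftI \<Gamma>) \<phi>;
      derivable c (rename (case_nat 1 (\<lambda>n. n + 2)) id \<phi> # Succ 1 0 # map (shiftI \<circ> shiftI) \<Gamma>)
        (rename (case_nat 0 (\<lambda>n. n + 2)) id \<phi>)\<rbrakk>
    \<Longrightarrow> derivable c \<Gamma> (instI \<phi> x)"
| comprehension: "\<lbrakk>c = MSO; derivable c \<Gamma> (substP \<phi> \<psi>)\<rbrakk> \<Longrightarrow> derivable c \<Gamma> (ExP \<phi>)"
| neg_comprehension: "\<lbrakk>c = SMSO; derivable c \<Gamma> (substP \<phi> \<psi>)\<rbrakk>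
    \<Longrightarrow> derivable c \<Gamma> (Neg (Neg (ExP \<phi>)))"
| sync_comprehension: "\<lbrakk>c = SMSO; uniformly_bounded 0 \<phi>; derivable c \<Gamma> (substP \<psi> \<phi>)\<rbrakk>
    \<Longrightarrow> derivable c \<Gamma> (ExP \<psi>)"

end

theory Submission
  imports Defs
begin

text \<open>
  Double negation is a monad for derivability in SMSO, and without a primitive universal quantifier
  it passes through every rule of MSO.  Since a negation is deterministic, the restricted
  induction rule of SMSO applies to \<open>Neg (Neg \<phi>)\<close> for arbitrary \<open>\<phi>\<close>; for the same reason, and because
  atoms are deterministic, premises with atomic or negated formulae are freed of their double negations
  by the restricted elimination rule.
\<close>

text \<open>Comparing contexts as sets gives weakening, exchange and contraction at once.
  \<open>\<Delta>\<close> is arbitrary because some premises add hypotheses or shift the context;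
  consing a formula and mapping a shift both preserve the inclusion.\<close>

lemma derivable_weaken:
  "derivable c \<Gamma> \<phi> \<Longrightarrow> set \<Gamma> \<subseteq> set \<Delta> \<Longrightarrow> derivable c \<Delta> \<phi>"
proof (induction arbitrary: \<Delta> rule: derivable.induct)
  case (cut \<Gamma> \<psi> \<phi>)
  show ?case
    by (rule derivable.cut[OF cut.IH])
      (use cut.prems in \<open>auto simp: image_mono subset_insertI2\<close>)
next
  case (neg_intro \<phi> \<Gamma>)
  show ?case
    by (rule derivable.neg_intro[OF neg_intro.IH])
      (use neg_intro.prems in \<open>auto simp: image_mono subset_insertI2\<close>)
next
  case (exI_elim \<Gamma> \<phi> \<psi>)
  show ?case
    by (rule derivable.exI_elim[OF exI_elim.IH])
      (use exI_elim.prems in \<open>auto simp: image_mono subset_insertI2\<close>)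
next
  case (exP_elim \<Gamma> \<phi> \<psi>)
  show ?case
    by (rule derivable.exP_elim[OF exP_elim.IH])
      (use exP_elim.prems in \<open>auto simp: image_mono subset_insertI2\<close>)
next
  case (induction \<phi> \<Gamma> x)
  show ?case
    by (rule derivable.induction[OF induction.hyps(1) induction.IH])
      (use induction.prems in \<open>auto simp: image_mono subset_insertI2\<close>)
next
  case (ax \<phi> \<Gamma>)
  then show ?case by (blast intro: derivable.ax)
next
  case (neg_elim \<Gamma> \<phi>)
  then show ?case by (blast intro: derivable.neg_elim)
next
  case (and_elim1 \<Gamma> \<phi> \<psi>)
  then show ?case by (blast intro: derivable.and_elim1)
next
  case (and_elim2 \<Gamma> \<phi> \<psi>)
  then show ?case by (blast intro: derivable.and_elim2)
next
  case (eq_subst \<Gamma> \<phi> y z)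
  then show ?case by (blast intro: derivable.eq_subst)
next
  case (leq_trans \<Gamma> x y z)
  then show ?case by (blast intro: derivable.leq_trans)
next
  case (dne \<phi> \<Gamma>)
  then show ?case by (blast intro: derivable.dne)
next
  case (zero_unique \<Gamma> x y)
  then show ?case by (blast intro: derivable.zero_unique)
next
  case (succ_inj \<Gamma> y x z)
  then show ?case by (blast intro: derivable.succ_inj)
next
  case (succ_unique \<Gamma> x y z)
  then show ?case by (blast intro: derivable.succ_unique)
next
  case (succ_nonzero \<Gamma> x y)
  then show ?case by (blast intro: derivable.succ_nonzero)
qed (blast intro: derivable.and_intro derivable.exI_intro derivable.exP_intro derivable.eq_refl
    derivable.leq_refl derivable.leq_antisym derivable.zero_exists derivable.succ_exists
    derivable.succ_leq derivable.leq_succ derivable.comprehension derivable.neg_comprehension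
    derivable.sync_comprehension)+

lemma derivable_weaken_Cons: "derivable c \<Gamma> \<phi> \<Longrightarrow> derivable c (\<psi> # \<Gamma>) \<phi>"
  by (erule derivable_weaken) auto

lemma derivable_hd: "derivable c (\<phi> # \<Gamma>) \<phi>"
  by (rule ax) simp

lemma derivable_neg_neg_intro:
  assumes "derivable c \<Gamma> \<phi>"
  shows "derivable c \<Gamma> (Neg (Neg \<phi>))"
proof (rule neg_intro, rule neg_elim)
  show "derivable c (Neg \<phi> # \<Gamma>) \<phi>"
    using assms by (rule derivable_weaken_Cons)
  show "derivable c (Neg \<phi> # \<Gamma>) (Neg \<phi>)"
    by (rule derivable_hd)
qed

text \<open>Under \<open>Neg \<psi>\<close>, the formula \<open>\<phi>\<close> is refutable because
  it yields \<open>Neg (Neg \<psi>)\<close>; this contradicts the first premise. Only the negation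
  rules and weakening are used, so both calculi have this principle for arbitrary formulae.\<close>

lemma derivable_neg_neg_bind:
  assumes \<phi>: "derivable c \<Gamma> (Neg (Neg \<phi>))" and \<psi>: "derivable c (\<phi> # \<Gamma>) (Neg (Neg \<psi>))"
  shows "derivable c \<Gamma> (Neg (Neg \<psi>))"
proof (rule neg_intro, rule neg_elim)
  show "derivable c (Neg \<psi> # \<Gamma>) (Neg \<phi>)"
  proof (rule neg_intro, rule neg_elim)
    show "derivable c (\<phi> # Neg \<psi> # \<Gamma>) (Neg \<psi>)"
      by (rule ax) simp
    show "derivable c (\<phi> # Neg \<psi> # \<Gamma>) (Neg (Neg \<psi>))"
      by (rule derivable_weaken[OF \<psi>]) auto
  qed
  show "derivable c (Neg \<psi> # \<Gamma>) (Neg (Neg \<phi>))"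
    by (rule derivable_weaken_Cons[OF \<phi>])
qed

lemma derivable_neg_neg_map:
  assumes "derivable c \<Gamma> (Neg (Neg \<phi>))" "derivable c (\<phi> # \<Gamma>) \<psi>"
  shows "derivable c \<Gamma> (Neg (Neg \<psi>))"
  using assms derivable_neg_neg_bind derivable_neg_neg_intro by blast

lemma SMSO_dne_deterministic:
  "derivable SMSO \<Gamma> (Neg (Neg \<phi>)) \<Longrightarrow> deterministic \<phi> \<Longrightarrow> derivable SMSO \<Gamma> \<phi>"
  by (rule dne) auto

text \<open>Induction on the MSO derivation. The context is left untranslated, so a hypothesis
  discharged by an MSO rule already has the form that the SMSO rule discharges.\<close>

lemma derivable_MSO_imp_SMSO_neg_neg:
  "derivable MSO \<Gamma> \<phi> \<Longrightarrow> derivable SMSO \<Gamma> (Neg (Neg \<phi>))"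
proof (induction rule: derivable.induct)
  case (ax \<phi> \<Gamma>)
  then show ?case by (rule derivable_neg_neg_intro[OF derivable.ax])
next
  case (cut \<Gamma> \<psi> \<phi>)
  show ?case by (rule derivable_neg_neg_bind[OF cut.IH])
next
  case (neg_elim \<Gamma> \<phi>)
  \<comment> \<open>The two induction hypotheses are \<open>Neg (Neg \<phi>)\<close> and its double
    negation on \<open>Neg \<phi>\<close>, which already contradict each other: the second is the
    negation of the first.\<close>
  show ?case by (rule derivable_neg_neg_intro[OF derivable.neg_elim[OF neg_elim.IH]])
next
  case (neg_intro \<phi> \<Gamma>)
  \<comment> \<open>\<open>Bot\<close> is deterministic, so its double negation can be removed
    before \<open>\<phi>\<close> is discharged.\<close>
  from neg_intro.IH have "derivable SMSO (\<phi> # \<Gamma>) Bot"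
    by (rule SMSO_dne_deterministic) simp
  then show ?case
    by (rule derivable_neg_neg_intro[OF derivable.neg_intro])
next
  case (and_intro \<Gamma> \<phi> \<psi>)
  have "derivable SMSO (\<psi> # \<phi> # \<Gamma>) (And \<phi> \<psi>)"
    by (rule derivable.and_intro; rule derivable.ax) simp_all
  with derivable_weaken_Cons[OF and_intro.IH(2)]
  have "derivable SMSO (\<phi> # \<Gamma>) (Neg (Neg (And \<phi> \<psi>)))"
    by (rule derivable_neg_neg_map)
  with and_intro.IH(1) show ?case by (rule derivable_neg_neg_bind)
next
  case (and_elim1 \<Gamma> \<phi> \<psi>)
  show ?case
    by (rule derivable_neg_neg_map[OF and_elim1.IH derivable.and_elim1[OF derivable_hd]])
next
  case (and_elim2 \<Gamma> \<phi> \<psi>)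
  show ?case
    by (rule derivable_neg_neg_map[OF and_elim2.IH derivable.and_elim2[OF derivable_hd]])
next
  case (exI_intro \<Gamma> \<phi> y)
  show ?case
    by (rule derivable_neg_neg_map[OF exI_intro.IH derivable.exI_intro[OF derivable_hd]])
next
  case (exP_intro \<Gamma> \<phi> Y)
  show ?case
    by (rule derivable_neg_neg_map[OF exP_intro.IH derivable.exP_intro[OF derivable_hd]])
next
  case (exI_elim \<Gamma> \<phi> \<psi>)
  \<comment> \<open>Only the double negation of \<open>ExI \<phi>\<close> is derivable, so
    \<open>ExI \<phi>\<close> is taken as a hypothesis to eliminate, and the bind removes it
    afterwards. Shifting commutes with negation.\<close>
  have "derivable SMSO (\<phi> # map shiftI (ExI \<phi> # \<Gamma>)) (shiftI (Neg (Neg \<psi>)))"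
    using derivable_weaken[OF exI_elim.IH(2), of "\<phi> # map shiftI (ExI \<phi> # \<Gamma>)"]
    by (auto simp: shiftI_def)
  then have "derivable SMSO (ExI \<phi> # \<Gamma>) (Neg (Neg \<psi>))"
    by (rule derivable.exI_elim[OF derivable_hd])
  with exI_elim.IH(1) show ?case by (rule derivable_neg_neg_bind)
next
  case (exP_elim \<Gamma> \<phi> \<psi>)
  have "derivable SMSO (\<phi> # map shiftP (ExP \<phi> # \<Gamma>)) (shiftP (Neg (Neg \<psi>)))"
    using derivable_weaken[OF exP_elim.IH(2), of "\<phi> # map shiftP (ExP \<phi> # \<Gamma>)"]
    by (auto simp: shiftP_def)
  then have "derivable SMSO (ExP \<phi> # \<Gamma>) (Neg (Neg \<psi>))"
    by (rule derivable.exP_elim[OF derivable_hd])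
  with exP_elim.IH(1) show ?case by (rule derivable_neg_neg_bind)
next
  case (eq_subst \<Gamma> \<phi> y z)
  \<comment> \<open>Replacement of equals is unrestricted, so it is applied to the doubly negated
    formula; only the equation must lose its double negation.\<close>
  have "derivable SMSO \<Gamma> (instI (Neg (Neg \<phi>)) y)"
    using eq_subst.IH(1) by (simp add: instI_def)
  moreover have "derivable SMSO \<Gamma> (Eq y z)"
    using eq_subst.IH(2) by (rule SMSO_dne_deterministic) simp
  ultimately have "derivable SMSO \<Gamma> (instI (Neg (Neg \<phi>)) z)"
    by (rule derivable.eq_subst)
  then show ?case by (simp add: instI_def)
next
  case (dne \<phi> \<Gamma>)
  \<comment> \<open>Four negations reduce to two, since \<open>Neg (Neg \<phi>)\<close> is
    deterministic for every \<open>\<phi>\<close>.\<close>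
  from dne.IH show ?case by (rule SMSO_dne_deterministic) simp
next
  case (induction \<phi> \<Gamma> x)
  have "derivable SMSO \<Gamma> (instI (Neg (Neg \<phi>)) x)"
  proof (rule derivable.induction)
    let ?y = "case_nat 1 (\<lambda>n. n + 2) :: nat \<Rightarrow> nat"
    let ?z = "case_nat 0 (\<lambda>n. n + 2) :: nat \<Rightarrow> nat"
    let ?\<Delta> = "Succ 1 0 # map (shiftI \<circ> shiftI) \<Gamma>"
    show "derivable SMSO (IsZero 0 # map shiftI \<Gamma>) (Neg (Neg \<phi>))"
      by (rule induction.IH(1))
    \<comment> \<open>The step now assumes only the double negation of the formula at the
      predecessor. As its goal is doubly negated too, the bind recovers the undecorated
      hypothesis.\<close>
    have "derivable SMSO (rename ?y id (Neg (Neg \<phi>)) # ?\<Delta>) (Neg (Neg (rename ?z id \<phi>)))"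
    proof (rule derivable_neg_neg_bind)
      show "derivable SMSO (rename ?y id (Neg (Neg \<phi>)) # ?\<Delta>) (Neg (Neg (rename ?y id \<phi>)))"
        by (rule derivable.ax) simp
      show "derivable SMSO (rename ?y id \<phi> # rename ?y id (Neg (Neg \<phi>)) # ?\<Delta>)
          (Neg (Neg (rename ?z id \<phi>)))"
        by (rule derivable_weaken[OF induction.IH(2)]) auto
    qed
    then show "derivable SMSO (rename ?y id (Neg (Neg \<phi>)) # ?\<Delta>) (rename ?z id (Neg (Neg \<phi>)))"
      by simp
  qed simp
  then show ?case by (simp add: instI_def)
next
  case (comprehension \<Gamma> \<phi> \<psi>)
  \<comment> \<open>Negative comprehension needs the instance itself, so the instance is assumed and
    then bound; its conclusion already carries the double negation.\<close>
  have "derivable SMSO (substP \<phi> \<psi> # \<Gamma>) (Neg (Neg (ExP \<phi>)))"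
    by (rule derivable.neg_comprehension[OF refl derivable_hd])
  with comprehension.IH show ?case by (rule derivable_neg_neg_bind)
next
  case (leq_trans \<Gamma> x y z)
  show ?case
    \<comment> \<open>Here and in the remaining arithmetic cases every premise is an atom or a
      negated atom, hence deterministic.\<close>
    by (rule derivable_neg_neg_intro[OF derivable.leq_trans[OF leq_trans.IH[THEN SMSO_dne_deterministic]]]) simp_all
next
  case (leq_antisym \<Gamma> x y)
  show ?case
    by (rule derivable_neg_neg_intro[OF derivable.leq_antisym[OF leq_antisym.IH[THEN SMSO_dne_deterministic]]]) simp_all
next
  case (zero_unique \<Gamma> x y)
  show ?case
    by (rule derivable_neg_neg_intro[OF derivable.zero_unique[OF zero_unique.IH[THEN SMSO_dne_deterministic]]]) simp_all
next
  case (succ_inj \<Gamma> y x z)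
  show ?case
    by (rule derivable_neg_neg_intro[OF derivable.succ_inj[OF succ_inj.IH[THEN SMSO_dne_deterministic]]]) simp_all
next
  case (succ_unique \<Gamma> x y z)
  show ?case
    by (rule derivable_neg_neg_intro[OF derivable.succ_unique[OF succ_unique.IH[THEN SMSO_dne_deterministic]]]) simp_all
next
  case (succ_nonzero \<Gamma> x y)
  show ?case
    by (rule derivable_neg_neg_intro[OF derivable.succ_nonzero[OF succ_nonzero.IH[THEN SMSO_dne_deterministic]]]) simp_all
next
  case (succ_leq \<Gamma> x y)
  show ?case
    by (rule derivable_neg_neg_intro[OF derivable.succ_leq[OF succ_leq.IH[THEN SMSO_dne_deterministic]]]) simp_all
next
  case (leq_succ \<Gamma> y y' x)
  show ?case
    by (rule derivable_neg_neg_intro[OF derivable.leq_succ[OF leq_succ.IH[THEN SMSO_dne_deterministic]]]) simp_all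
\<comment> \<open>The cases of negative and synchronous comprehension are vacuous, since their side
  condition reads \<open>MSO = SMSO\<close>.\<close>
qed (simp_all add: derivable_neg_neg_intro derivable.eq_refl derivable.leq_refl derivable.zero_exists
    derivable.succ_exists)

theorem theorem3p6:
  fixes \<phi> :: form
  shows "(derivable MSO [] \<phi> \<longrightarrow> derivable SMSO [] (Neg (Neg \<phi>))) \<and>
    (\<forall>\<Gamma>. derivable MSO \<Gamma> \<phi> \<longrightarrow> derivable SMSO \<Gamma> (Neg (Neg \<phi>)))"
  using derivable_MSO_imp_SMSO_neg_neg by blast

end
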